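(* Let $\mathcal{H}$ be a complex Hilbert space, $\mathcal{D}$ a dense subspace of $\mathcal{H}$, $\Omega$ a sesquilinear form on $\mathcal{D}$ which is q-closed with respect to a norm $\|\cdot\|_\Omega$, with numerical range $\mathfrak{n}_\Omega$, and let $\Upsilon$ be a bounded sesquilinear form on $\mathcal{H}$. Assume that $\mathfrak{n}_\Omega\cap\mathfrak{n}_{-\Upsilon}=\varnothing$, where $\mathfrak{n}_{-\Upsilon}$ is the numerical range of $-\Upsilon$. Then $\Upsilon\in\mathfrak{P}(\Omega)$ if and only if one of the following statements 1 or 2 holds: 1. if $\{\xi_n\}$ is a sequence in $\mathcal{D}$ such that $\sup_{\|\eta\|_\Omega=1}|(\Omega+\Upsilon)(\xi_n,\eta)|\to0$, then $\|\xi_n\|_\Omega\to0$; 2. there exists a constant $c>0$ such that $c\|\xi\|_\Omega\le\sup_{\|\eta\|_\Omega=1}|(\Omega+\Upsilon)(\xi,\eta)|$ for all $\xi\in\mathcal{D}$.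
   Context: Let $\|\cdot\|$ be the norm of $\mathcal{H}$. Sesquilinear forms are linear in the first variable and conjugate linear in the second. The numerical range of a form $\Omega$ on $\mathcal{D}$ is $\mathfrak{n}_\Omega=\{\Omega(\xi,\xi):\xi\in\mathcal{D},\|\xi\|=1\}$; for a bounded form on $\mathcal{H}$ the domain is $\mathcal{H}$. A sesquilinear form $\Omega$ on the dense subspace $\mathcal{D}$ is q-closed with respect to a norm $\|\cdot\|_\Omega$ on $\mathcal{D}$ if: (1) there is $\alpha>0$ with $\|\xi\|\le\alpha\|\xi\|_\Omega$ for all $\xi\in\mathcal{D}$; (2) if $\{\xi_n\}\subset\mathcal{D}$, $\|\xi_n\|\to0$ and $\|\xi_n-\xi_m\|_\Omega\to0$, then $\|\xi_n\|_\Omega\to0$; (3) $\mathcal{E}_\Omega:=\mathcal{D}[\|\cdot\|_\Omega]$ is a reflexive Banach space; (4) there is $\beta>0$ with $|\Omega(\xi,\eta)|\le\beta\|\xi\|_\Omega\|\eta\|_\Omega$ for all $\xi,\eta\in\mathcal{D}$. Let $\mathcal{E}_\Omega^\times$ be the conjugate dual of $\mathcal{E}_\Omega$ (bounded conjugate linear functionals). $\mathfrak{P}(\Omega)$ is the set of bounded sesquilinear forms $\Upsilon$ on $\mathcal{H}$ such that (i) if $\xi\in\mathcal{D}$ and $(\Omega+\Upsilon)(\xi,\eta)=0$ for all $\eta\in\mathcal{D}$, then $\xi=0$; (ii) for every $\Lambda\in\mathcal{E}_\Omega^\times$ there is $\xi\in\mathcal{D}$ with $\Lambda(\eta)=(\Omega+\Upsilon)(\xi,\eta)$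 for all $\eta\in\mathcal{D}$. *)

theory Defs
  imports "HOL-Analysis.Analysis" "HOL-Library.Function_Algebras"
begin

section \<open>Complex Hilbert spaces\<close>

class complex_vector = real_vector +
  fixes scaleC :: "complex \<Rightarrow> 'a \<Rightarrow> 'a" (infixr "*\<^sub>C" 75)
  assumes scaleC_add_right: "c *\<^sub>C (x + y) = c *\<^sub>C x + c *\<^sub>C y"
    and scaleC_add_left: "(c + d) *\<^sub>C x = c *\<^sub>C x + d *\<^sub>C x"
    and scaleC_scaleC: "c *\<^sub>C d *\<^sub>C x = (c * d) *\<^sub>C x"
    and scaleC_one: "1 *\<^sub>C x = x"
    and scaleC_of_real: "complex_of_real r *\<^sub>C x = r *\<^sub>R x"

global_interpretation complex_vector:
  vector_space "scaleC :: complex \<Rightarrow> 'a \<Rightarrow> 'a::complex_vector"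
  by unfold_locales (simp_all add: scaleC_add_right scaleC_add_left scaleC_scaleC scaleC_one)

text \<open>Linear in the first variable, conjugate linear in the second.
  Positive definiteness of the inner product follows from the last axiom.\<close>

class complex_inner = complex_vector + real_normed_vector +
  fixes cinner :: "'a \<Rightarrow> 'a \<Rightarrow> complex"
  assumes cinner_commute: "cinner x y = cnj (cinner y x)"
    and cinner_add_left: "cinner (x + y) z = cinner x z + cinner y z"
    and cinner_scaleC_left: "cinner (c *\<^sub>C x) y = c * cinner x y"
    and cinner_self: "cinner x x = complex_of_real ((norm x)\<^sup>2)"

class complex_hilbert_space = complex_inner + complete_space


section \<open>Normed spaces on a carrier set, dual and bidual\<close>

text \<open>The scalar multiplication is a parameter, so that \<open>dual\<close> can be iterated:
  the dual is a set of functions, with pointwise operations.\<close>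

definition norm_on :: "(complex \<Rightarrow> 'v \<Rightarrow> 'v::ab_group_add) \<Rightarrow> 'v set \<Rightarrow> ('v \<Rightarrow> real) \<Rightarrow> bool" where
  "norm_on s V N \<longleftrightarrow>
     (\<forall>x\<in>V. 0 \<le> N x) \<and>
     (\<forall>x\<in>V. N x = 0 \<longleftrightarrow> x = 0) \<and>
     (\<forall>c. \<forall>x\<in>V. N (s c x) = cmod c * N x) \<and>
     (\<forall>x\<in>V. \<forall>y\<in>V. N (x + y) \<le> N x + N y)"

definition cauchy_on :: "('v::ab_group_add \<Rightarrow> real) \<Rightarrow> (nat \<Rightarrow> 'v) \<Rightarrow> bool" where
  "cauchy_on N X \<longleftrightarrow> (\<forall>e>0. \<exists>M. \<forall>m\<ge>M. \<forall>n\<ge>M. N (X n - X m) < e)"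

definition complete_on :: "'v::ab_group_add set \<Rightarrow> ('v \<Rightarrow> real) \<Rightarrow> bool" where
  "complete_on V N \<longleftrightarrow>
     (\<forall>X. range X \<subseteq> V \<and> cauchy_on N X \<longrightarrow> (\<exists>x\<in>V. (\<lambda>n. N (X n - x)) \<longlonglongrightarrow> 0))"

text \<open>Functionals on \<open>V\<close> are represented by functions vanishing off \<open>V\<close>, so that two of
  them are equal as soon as they agree on \<open>V\<close>.\<close>

definition dual ::
  "(complex \<Rightarrow> 'v \<Rightarrow> 'v::ab_group_add) \<Rightarrow> 'v set \<Rightarrow> ('v \<Rightarrow> real) \<Rightarrow> ('v \<Rightarrow> complex) set" where
  "dual s V N = {f.
     (\<forall>x\<in>V. \<forall>y\<in>V. f (x + y) = f x + f y) \<and>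
     (\<forall>c. \<forall>x\<in>V. f (s c x) = c * f x) \<and>
     (\<exists>K. \<forall>x\<in>V. cmod (f x) \<le> K * N x) \<and>
     (\<forall>x. x \<notin> V \<longrightarrow> f x = 0)}"

definition conj_dual ::
  "(complex \<Rightarrow> 'v \<Rightarrow> 'v::ab_group_add) \<Rightarrow> 'v set \<Rightarrow> ('v \<Rightarrow> real) \<Rightarrow> ('v \<Rightarrow> complex) set" where
  "conj_dual s V N = {f.
     (\<forall>x\<in>V. \<forall>y\<in>V. f (x + y) = f x + f y) \<and>
     (\<forall>c. \<forall>x\<in>V. f (s c x) = cnj c * f x) \<and>
     (\<exists>K. \<forall>x\<in>V. cmod (f x) \<le> K * N x) \<and>
     (\<forall>x. x \<notin> V \<longrightarrow> f x = 0)}"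

definition dual_norm :: "'v set \<Rightarrow> ('v \<Rightarrow> real) \<Rightarrow> ('v \<Rightarrow> complex) \<Rightarrow> real" where
  "dual_norm V N f = (SUP x\<in>{x\<in>V. N x \<le> 1}. cmod (f x))"

abbreviation scale_fun :: "complex \<Rightarrow> ('v \<Rightarrow> complex) \<Rightarrow> 'v \<Rightarrow> complex" where
  "scale_fun c f \<equiv> (\<lambda>x. c * f x)"

definition reflexive_on ::
  "(complex \<Rightarrow> 'v \<Rightarrow> 'v::ab_group_add) \<Rightarrow> 'v set \<Rightarrow> ('v \<Rightarrow> real) \<Rightarrow> bool" where
  "reflexive_on s V N \<longleftrightarrow>
     (\<forall>\<phi> \<in> dual scale_fun (dual s V N) (dual_norm V N). \<exists>x\<in>V. \<forall>f \<in> dual s V N. \<phi> f = f x)"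


section \<open>Sesquilinear forms\<close>

definition sesquilinear_on ::
  "'h::complex_vector set \<Rightarrow> ('h \<Rightarrow> 'h \<Rightarrow> complex) \<Rightarrow> bool" where
  "sesquilinear_on D \<Omega> \<longleftrightarrow>
     (\<forall>x\<in>D. \<forall>y\<in>D. \<forall>z\<in>D. \<Omega> (x + y) z = \<Omega> x z + \<Omega> y z) \<and>
     (\<forall>c. \<forall>x\<in>D. \<forall>y\<in>D. \<Omega> (c *\<^sub>C x) y = c * \<Omega> x y) \<and>
     (\<forall>x\<in>D. \<forall>y\<in>D. \<forall>z\<in>D. \<Omega> x (y + z) = \<Omega> x y + \<Omega> x z) \<and>
     (\<forall>c. \<forall>x\<in>D. \<forall>y\<in>D. \<Omega> x (c *\<^sub>C y) = cnj c * \<Omega> x y)"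

definition bounded_sesquilinear :: "('h::complex_inner \<Rightarrow> 'h \<Rightarrow> complex) \<Rightarrow> bool" where
  "bounded_sesquilinear \<Upsilon> \<longleftrightarrow>
     sesquilinear_on UNIV \<Upsilon> \<and> (\<exists>K. \<forall>x y. cmod (\<Upsilon> x y) \<le> K * norm x * norm y)"

definition numerical_range ::
  "'h::complex_inner set \<Rightarrow> ('h \<Rightarrow> 'h \<Rightarrow> complex) \<Rightarrow> complex set" where
  "numerical_range D \<Omega> = {\<Omega> \<xi> \<xi> | \<xi>. \<xi> \<in> D \<and> norm \<xi> = 1}"

definition q_closed ::
  "'h::complex_inner set \<Rightarrow> ('h \<Rightarrow> real) \<Rightarrow> ('h \<Rightarrow> 'h \<Rightarrow> complex) \<Rightarrow> bool" where
  "q_closed D N \<Omega> \<longleftrightarrow>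
     (\<exists>\<alpha>>0. \<forall>\<xi>\<in>D. norm \<xi> \<le> \<alpha> * N \<xi>) \<and>
     (\<forall>X. range X \<subseteq> D \<and> (\<lambda>n. norm (X n)) \<longlonglongrightarrow> 0 \<and> cauchy_on N X
        \<longrightarrow> (\<lambda>n. N (X n)) \<longlonglongrightarrow> 0) \<and>
     complete_on D N \<and> reflexive_on scaleC D N \<and>
     (\<exists>\<beta>>0. \<forall>\<xi>\<in>D. \<forall>\<eta>\<in>D. cmod (\<Omega> \<xi> \<eta>) \<le> \<beta> * N \<xi> * N \<eta>)"

text \<open>The set \<open>P(\<Omega>)\<close>; sums of forms are pointwise.\<close>

definition frakP ::
  "'h::complex_inner set \<Rightarrow> ('h \<Rightarrow> real) \<Rightarrow> ('h \<Rightarrow> 'h \<Rightarrow> complex) \<Rightarrow>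
     ('h \<Rightarrow> 'h \<Rightarrow> complex) set" where
  "frakP D N \<Omega> = {\<Upsilon>. bounded_sesquilinear \<Upsilon> \<and>
     (\<forall>\<xi>\<in>D. (\<forall>\<eta>\<in>D. (\<Omega> + \<Upsilon>) \<xi> \<eta> = 0) \<longrightarrow> \<xi> = 0) \<and>
     (\<forall>\<Lambda> \<in> conj_dual scaleC D N. \<exists>\<xi>\<in>D. \<forall>\<eta>\<in>D. \<Lambda> \<eta> = (\<Omega> + \<Upsilon>) \<xi> \<eta>)}"

text \<open>The supremum of \<open>\<bar>\<Phi>(\<xi>, \<eta>)\<bar>\<close> over the unit sphere of \<open>D\<close>. It is taken in the extended
  non-negative reals, where it is \<open>0\<close> in the degenerate case \<open>D = {0}\<close>
  of an empty sphere.\<close>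

definition sup_sphere ::
  "'h set \<Rightarrow> ('h \<Rightarrow> real) \<Rightarrow> ('h \<Rightarrow> 'h \<Rightarrow> complex) \<Rightarrow> 'h \<Rightarrow> ennreal" where
  "sup_sphere D N \<Phi> \<xi> = (SUP \<eta>\<in>{\<eta>\<in>D. N \<eta> = 1}. ennreal (cmod (\<Phi> \<xi> \<eta>)))"

end

theory Submission
  imports Defs
begin

text \<open>
  Put \<open>\<Phi> = \<Omega> + \<Upsilon>\<close>. Disjointness of the numerical ranges says that \<open>\<Phi>(x, x) \<noteq> 0\<close> for
  \<open>x \<noteq> 0\<close> in \<open>D\<close>. If \<open>x \<mapsto> \<Phi>(x, \<cdot>)\<close> is bounded below, its range in the conjugate dual is
  closed, and it is dense because, by reflexivity, a functional annihilating it is evaluation at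
  some \<open>x\<close>, for which \<open>\<Phi>(x, x) = 0\<close>. Conversely, if \<open>x \<mapsto> \<Phi>(x, \<cdot>)\<close> is onto, a uniform
  boundedness argument shows that the adjoint form is bounded below; the adjoint form also has
  no zeros on the diagonal, so it is onto too, and the same argument applied to it shows that
  \<open>\<Phi>\<close> is bounded below.
\<close>

section \<open>The Hahn--Banach theorem for seminorms\<close>

text \<open>The scaling is an argument because it will be the restriction to real scalars of an
  arbitrary complex scaling, such as the pointwise one on functions.\<close>

definition sublinear :: "(real \<Rightarrow> 'v \<Rightarrow> 'v::ab_group_add) \<Rightarrow> ('v \<Rightarrow> real) \<Rightarrow> bool" where
  "sublinear s p \<longleftrightarrow>
     (\<forall>x y. p (x + y) \<le> p x + p y) \<and> (\<forall>r\<ge>0. \<forall>x. p (s r x) = r * p x)"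

text \<open>Nonnegativity is a consequence on a subspace:
  \<open>0 = p 0 \<le> p x + p (- x) = 2 * p x\<close>.\<close>

definition seminorm_on :: "(complex \<Rightarrow> 'v \<Rightarrow> 'v::ab_group_add) \<Rightarrow> 'v set \<Rightarrow> ('v \<Rightarrow> real) \<Rightarrow> bool" where
  "seminorm_on s V p \<longleftrightarrow>
     (\<forall>x\<in>V. \<forall>y\<in>V. p (x + y) \<le> p x + p y) \<and> (\<forall>c. \<forall>x\<in>V. p (s c x) = cmod c * p x)"

text \<open>Every sublinear \<open>q \<le> p\<close> then satisfies
  \<open>- p (- x) \<le> - q (- x) \<le> q x\<close>, a bound uniform in \<open>q\<close> that keeps
  infima of such families finite.\<close>

lemma sublinear_lower_bound:
  assumes "vector_space s" "sublinear s p"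
  shows "- p (- x) \<le> p x"
proof -
  interpret vector_space s by fact
  have "p 0 = 0"
    using assms(2) unfolding sublinear_def by (metis mult_zero_left order_refl scale_zero_left)
  moreover have "p (x + - x) \<le> p x + p (- x)"
    using assms(2) unfolding sublinear_def by blast
  ultimately show ?thesis by simp
qed

text \<open>Supplies the bounds for Zorn's lemma. Subadditivity survives the infimum because the
  smaller of two members of a chain serves both summands.\<close>

lemma sublinear_Inf_chain:
  assumes "vector_space s" and ne: "C \<noteq> {}"
    and sub: "\<And>q. q \<in> C \<Longrightarrow> sublinear s q \<and> (\<forall>x. q x \<le> p x)"
    and chain: "\<And>q q'. q \<in> C \<Longrightarrow> q' \<in> C \<Longrightarrow> (\<forall>x. q x \<le> q' x) \<or> (\<forall>x. q' x \<le> q x)"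
  shows "sublinear s (\<lambda>x. INF q\<in>C. q x)" (is "sublinear s ?i")
    and "q \<in> C \<Longrightarrow> (INF q\<in>C. q x) \<le> q x"
proof -
  have bdd: "bdd_below ((\<lambda>q. q x) ` C)" for x
  proof (rule bdd_belowI2)
    fix q assume "q \<in> C"
    then show "- p (- x) \<le> q x"
      using sublinear_lower_bound[OF assms(1), of q x] sub[of q]
      by (smt (verit, best))
  qed
  show le: "?i x \<le> q x" if "q \<in> C" for q x
    using bdd that by (rule cINF_lower)
  have add: "?i (x + y) \<le> ?i x + ?i y" for x y
  proof -
    have "?i (x + y) - q x \<le> ?i y" if q: "q \<in> C" for q
    proof (rule cINF_greatest[OF ne])
      fix q' assume q': "q' \<in> C"
      obtain r where "r \<in> C" "\<forall>z. r z \<le> q z" "\<forall>z. r z \<le> q' z"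
        using chain[OF q q'] q q' by blast
      then show "?i (x + y) - q x \<le> q' y"
        using le[of r "x + y"] sub[of r] unfolding sublinear_def by (smt (verit, best))
    qed
    then have "?i (x + y) - ?i y \<le> q x" if "q \<in> C" for q
      using that by (simp add: algebra_simps)
    then have "?i (x + y) - ?i y \<le> ?i x"
      by (rule cINF_greatest[OF ne])
    then show ?thesis by simp
  qed
  have "?i (s r x) = r * ?i x" if r: "r \<ge> 0" for r x
  proof -
    have "r * ?i x = (INF q\<in>C. r * q x)"
      using continuous_at_Inf_mono[of "\<lambda>t. r * t" "(\<lambda>q. q x) ` C"] bdd ne r
      by (simp add: mono_def mult_left_mono image_image continuous_mult_left)
    also have "\<dots> = ?i (s r x)"
      using sub r unfolding sublinear_def by (intro INF_cong) auto
    finally show ?thesis by simp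
  qed
  with add show "sublinear s ?i"
    unfolding sublinear_def by blast
qed

text \<open>The classical device that makes a minimal sublinear functional additive.\<close>

lemma sublinear_shift:
  assumes "vector_space s" and p: "sublinear s p"
  obtains q where "sublinear s q" "\<And>x. q x \<le> p x" "q (- v) \<le> - p v"
proof -
  interpret vector_space s by fact
  have padd: "p (x + y) \<le> p x + p y" and pscale: "r \<ge> 0 \<Longrightarrow> p (s r x) = r * p x" for x y r
    using p unfolding sublinear_def by auto
  \<comment> \<open>The parameter \<open>t = 0\<close> gives \<open>q \<le> p\<close>, and
    \<open>t = 1\<close> at \<open>- v\<close> gives \<open>q (- v) \<le> p 0 - p v\<close>.\<close>
  define q where "q x = (INF t\<in>{0..}. p (x + s t v) - t * p v)" for x
  have low: "- p (- x) \<le> p (x + s t v) - t * p v" if "t \<ge> 0" for x t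
    using padd[of "- x" "x + s t v"] pscale[OF that, of v] by (simp add: algebra_simps)
  then have bdd: "bdd_below ((\<lambda>t. p (x + s t v) - t * p v) ` {0..})" for x
    by (intro bdd_belowI2[where m = "- p (- x)"]) auto
  have qle: "q x \<le> p (x + s t v) - t * p v" if "t \<ge> 0" for x t
    unfolding q_def using bdd that by (intro cINF_lower) auto
  have qgr: "m \<le> q x" if "\<And>t. t \<ge> 0 \<Longrightarrow> m \<le> p (x + s t v) - t * p v" for m x
    unfolding q_def using that by (intro cINF_greatest) auto
  have p0: "p 0 = 0"
    using pscale[of 0 0] by simp
  have add: "q (x + y) \<le> q x + q y" for x y
  proof -
    have "q (x + y) - q y \<le> q x"
    proof (rule qgr)
      fix t :: real assume t: "t \<ge> 0"
      have "q (x + y) - (p (x + s t v) - t * p v) \<le> q y"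
      proof (rule qgr)
        fix u :: real assume u: "u \<ge> 0"
        \<comment> \<open>The shifts add up: \<open>t + u\<close> is an admissible parameter for
          \<open>x + y\<close>.\<close>
        have "q (x + y) \<le> p ((x + s t v) + (y + s u v)) - (t + u) * p v"
          using qle[of "t + u" "x + y"] t u by (simp add: algebra_simps)
        also have "\<dots> \<le> p (x + s t v) + p (y + s u v) - (t + u) * p v"
          using padd by simp
        finally show "q (x + y) - (p (x + s t v) - t * p v) \<le> p (y + s u v) - u * p v"
          by (simp add: algebra_simps)
      qed
      then show "q (x + y) - q y \<le> p (x + s t v) - t * p v" by simp
    qed
    then show ?thesis by simp
  qed
  have scale_le: "r * q x \<le> q (s r x)" if r: "r > 0" for r x
  proof (rule qgr)
    fix t :: real assume "t \<ge> 0"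
    \<comment> \<open>The parameter \<open>t\<close> for \<open>s r x\<close> corresponds to
      \<open>t / r\<close> for \<open>x\<close>.\<close>
    then have "r * q x \<le> r * (p (x + s (t / r) v) - t / r * p v)"
      using qle[of "t / r" x] r by simp
    also have "\<dots> = p (s r x + s t v) - t * p v"
      using pscale[of r "x + s (t / r) v"] r by (simp add: algebra_simps)
    finally show "r * q x \<le> p (s r x + s t v) - t * p v" .
  qed
  have "q (s r x) = r * q x" if r: "r \<ge> 0" for r x
  proof (cases "r = 0")
    case True
    have "q 0 = 0"
      using qle[of 0 0] p0 qgr[of 0 0] pscale[of _ v] by (intro antisym) auto
    with True show ?thesis by simp
  next
    case False
    with r have r: "r > 0" by simp
    have "inverse r * q (s r x) \<le> q x"
      using scale_le[of "inverse r" "s r x"] r by simp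
    then have "q (s r x) \<le> r * q x"
      using r by (simp add: field_simps)
    with scale_le[OF r] show ?thesis by (simp add: antisym)
  qed
  with add have "sublinear s q"
    unfolding sublinear_def by blast
  moreover have "q x \<le> p x" for x
    using qle[of 0 x] by simp
  moreover have "q (- v) \<le> - p v"
    using qle[of 1 "- v"] p0 by simp
  ultimately show ?thesis by (rule that)
qed

text \<open>A minimal sublinear \<open>f \<le> p\<close> cannot be lowered by
  \<open>sublinear_shift\<close>, so \<open>f (- v) \<le> - f v\<close> for every \<open>v\<close>;
  this turns subadditivity into additivity.\<close>

lemma sublinear_dominates_additive:
  assumes vs: "vector_space s" and p: "sublinear s p"
  obtains f where "sublinear s f" "\<And>x. f x \<le> p x" "\<And>x y. f (x + y) = f x + f y"
proof -
  define A where "A = {q. sublinear s q \<and> (\<forall>x. q x \<le> p x)}"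
  have "\<exists>m\<in>A. \<forall>q\<in>A. q \<le> m \<longrightarrow> q = m"
  proof (rule predicate_Zorn)
    \<comment> \<open>The order is reversed, so that a maximal element for Zorn's lemma is a minimal
      functional.\<close>
    show "partial_order_on A (relation_of (\<lambda>m q. q \<le> m) A)"
      by (rule partial_order_on_relation_ofI) auto
    fix C assume C: "C \<in> Chains (relation_of (\<lambda>m q. q \<le> m) A)"
    show "\<exists>u\<in>A. \<forall>q\<in>C. u \<le> q"
    proof (cases "C = {}")
      case True
      then show ?thesis using p unfolding A_def by auto
    next
      case False
      have CA: "C \<subseteq> A"
        using C unfolding Chains_def relation_of_def by auto
      have subC: "sublinear s q \<and> (\<forall>x. q x \<le> p x)" if "q \<in> C" for q
        using CA that unfolding A_def by auto
      have chain: "(\<forall>x. q x \<le> q' x) \<or> (\<forall>x. q' x \<le> q x)" if "q \<in> C" "q' \<in> C" for q q'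
        using C that by (auto simp: Chains_def relation_of_def le_fun_def)
      let ?i = "\<lambda>x. INF q\<in>C. q x"
      have sub: "sublinear s ?i"
        by (rule sublinear_Inf_chain(1)[OF vs False subC chain])
      have le: "?i x \<le> q x" if "q \<in> C" for q x
        by (rule sublinear_Inf_chain(2)[OF vs False subC chain that])
      obtain q where "q \<in> C" using False by blast
      with CA le[of q] have "?i x \<le> p x" for x
        unfolding A_def by (auto intro: order_trans)
      with sub have "?i \<in> A" unfolding A_def by blast
      moreover have "\<forall>q\<in>C. ?i \<le> q" using le by (auto simp: le_fun_def)
      ultimately show ?thesis by blast
    qed
  qed
  then obtain f where f: "f \<in> A" and min: "\<And>q. q \<in> A \<Longrightarrow> q \<le> f \<Longrightarrow> q = f"
    by blast
  have sub: "sublinear s f" and le: "\<And>x. f x \<le> p x"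
    using f unfolding A_def by auto
  have neg: "f (- v) \<le> - f v" for v
  proof -
    obtain q where q: "sublinear s q" "\<And>x. q x \<le> f x" "q (- v) \<le> - f v"
      using sublinear_shift[OF vs sub] by blast
    then have "q \<in> A" unfolding A_def using le by (auto intro: order_trans)
    then have "q = f" using min q(2) by (auto simp: le_fun_def)
    with q show ?thesis by simp
  qed
  have "f (x + y) = f x + f y" for x y
  proof (rule antisym)
    show "f (x + y) \<le> f x + f y" using sub unfolding sublinear_def by blast
    have "f x \<le> f (x + y) + f (- y)"
      using sub unfolding sublinear_def by (metis add.right_neutral add_diff_cancel_right' diff_conv_add_uminus)
    with neg[of y] show "f x + f y \<le> f (x + y)" by simp
  qed
  with sub le show ?thesis by (rule that)
qed

section \<open>Norming functionals for complex seminorms, and quotient seminorms\<close>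

text \<open>A real additive minorant \<open>g\<close> is complexified to
  \<open>g x - \<i> * g (s \<i> x)\<close>; rotating \<open>x\<close> by a unimodular factor carries
  the bound from the real part to the modulus.\<close>

lemma complex_norming_functional:
  assumes "vector_space (s :: complex \<Rightarrow> 'v::ab_group_add \<Rightarrow> 'v)" and p: "seminorm_on s UNIV p"
  obtains f where "\<And>x y. f (x + y) = f x + f y" "\<And>c x. f (s c x) = c * f x"
    "\<And>x. cmod (f x) \<le> p x" "f v = complex_of_real (p v)"
proof -
  interpret vector_space s by fact
  define sr where "sr r = s (complex_of_real r)" for r
  have vsr: "vector_space sr"
    unfolding sr_def by unfold_locales (auto simp: algebra_simps)
  have "sublinear sr p"
    using p unfolding sublinear_def seminorm_on_def sr_def by auto
  \<comment> \<open>Shifting at \<open>v\<close> first forces \<open>g (- v) \<le> - p v\<close>,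
    hence \<open>g v \<ge> p v\<close>, for every additive minorant \<open>g\<close> of
    \<open>q\<close>.\<close>
  then obtain q where q: "sublinear sr q" "\<And>x. q x \<le> p x" "q (- v) \<le> - p v"
    using sublinear_shift[OF vsr] by blast
  then obtain g where g: "sublinear sr g" "\<And>x. g x \<le> q x" and gadd: "\<And>x y. g (x + y) = g x + g y"
    using sublinear_dominates_additive[OF vsr] by blast
  have g0: "g 0 = 0" using gadd[of 0 0] by simp
  then have gm: "g (- x) = - g x" for x using gadd[of x "- x"] by simp
  have gle: "g x \<le> p x" for x using g(2) q(2) order_trans by blast
  have gsc: "g (s (complex_of_real r) x) = r * g x" for r x
  proof (cases "r \<ge> 0")
    case True
    then show ?thesis using g(1) unfolding sublinear_def sr_def by blast
  next
    case False
    then have "g (s (complex_of_real (- r)) (- x)) = (- r) * g (- x)"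
      using g(1) unfolding sublinear_def sr_def by (metis le_cases neg_0_le_iff_le)
    then show ?thesis using gm by simp
  qed
  have gv: "g v = p v"
    using gle[of v] g(2)[of "- v"] q(3) gm[of v] by simp
  define f where "f x = Complex (g x) (- g (s \<i> x))" for x
  have add: "f (x + y) = f x + f y" for x y
    unfolding f_def by (simp add: gadd scale_right_distrib complex_eq_iff)
  have sc: "f (s c x) = c * f x" for c x
  proof -
    have "s c x = s (of_real (Re c)) x + s (of_real (Im c)) (s \<i> x)"
      by (simp flip: scale_left_distrib add: complex_eq mult.commute)
    then have 1: "g (s c x) = Re c * g x + Im c * g (s \<i> x)"
      using gadd gsc by (metis scale_scale)
    have "s \<i> (s c x) = s (of_real (Re c)) (s \<i> x) + s (of_real (- Im c)) x"
    proof -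
      have "\<i> * c = of_real (Re c) * \<i> + of_real (- Im c)"
        by (simp add: complex_eq_iff)
      then show ?thesis
        by (metis scale_left_distrib scale_scale)
    qed
    then have 2: "g (s \<i> (s c x)) = Re c * g (s \<i> x) - Im c * g x"
      using gadd gsc by (metis minus_mult_left uminus_add_conv_diff add.commute)
    show ?thesis
      unfolding f_def using 1 2 by (simp add: complex_eq_iff algebra_simps)
  qed
  have le: "cmod (f x) \<le> p x" for x
  proof (cases "f x = 0")
    case True
    have "0 \<le> p x"
    proof -
      have "0 = p (s 0 x)" using p unfolding seminorm_on_def by (metis UNIV_I mult_zero_left norm_zero)
      also have "\<dots> = p (x + s (- 1) x)" by simp
      also have "\<dots> \<le> p x + p (s (- 1) x)" using p unfolding seminorm_on_def by blast
      also have "p (s (- 1) x) = p x" using p unfolding seminorm_on_def by (metis UNIV_I norm_minus_cancel norm_one mult_1)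
      finally show ?thesis by simp
    qed
    with True show ?thesis by simp
  next
    case False
    \<comment> \<open>This factor makes \<open>f (s c x)\<close> equal to the real number
      \<open>cmod (f x)\<close>, hence to its own real part \<open>g (s c x)\<close>.\<close>
    define c where "c = cnj (f x) / cmod (f x)"
    have cx: "f (s c x) = cmod (f x)"
      unfolding sc c_def using False complex_norm_square[of "f x"]
      by (simp add: divide_eq_eq power2_eq_square mult.commute)
    have c: "cmod c = 1" unfolding c_def using False by (simp add: norm_divide)
    have "cmod (f x) = g (s c x)"
      using cx unfolding f_def by (metis Re_complex_of_real complex.sel(1))
    also have "\<dots> \<le> p (s c x)" by (rule gle)
    also have "\<dots> = p x" using p c unfolding seminorm_on_def by simp
    finally show ?thesis .
  qed
  have "f v = complex_of_real (p v)"
  proof -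
    have "Re (f v) = p v" using gv by (simp add: f_def)
    \<comment> \<open>The real part already attains the bound \<open>p v\<close> for the modulus,
      which leaves no room for an imaginary part.\<close>
    moreover from this le[of v] have "Im (f v) = 0"
      by (metis abs_le_square_iff abs_norm_cancel add_le_same_cancel1 cmod_power2 norm_ge_zero
          order_trans power2_abs power_mono zero_eq_power2 zero_le_power2 antisym)
    ultimately show ?thesis by (simp add: complex_eq_iff)
  qed
  with add sc le show ?thesis by (rule that)
qed

text \<open>Composition with a linear projection onto \<open>V\<close> extends \<open>p\<close> to a
  seminorm on the whole type without changing it on \<open>V\<close>.\<close>

lemma norming_functional_on:
  assumes "vector_space (s :: complex \<Rightarrow> 'v::ab_group_add \<Rightarrow> 'v)"
    and V: "module.subspace s V" and p: "seminorm_on s V p" and v: "v \<in> V"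
  obtains f where "\<And>x y. f (x + y) = f x + f y" "\<And>c x. f (s c x) = c * f x"
    "\<And>x. x \<in> V \<Longrightarrow> cmod (f x) \<le> p x" "f v = complex_of_real (p v)"
proof -
  interpret vector_space_pair s s
    using assms(1) by (simp add: vector_space_pair_def)
  obtain P where P: "range P \<subseteq> V" "Vector_Spaces.linear s s P" "\<And>x. x \<in> V \<Longrightarrow> P x = x"
    using linear_exists_left_inverse_on[OF vs1.linear_id V] by auto
  interpret P: Vector_Spaces.linear s s P by fact
  have "seminorm_on s UNIV (\<lambda>x. p (P x))"
    using p P(1) unfolding seminorm_on_def by (simp add: P.add P.scale image_subset_iff)
  from complex_norming_functional[OF assms(1) this, of v] P(3) v show ?thesis
    by (metis that)
qed

text \<open>This is the distance to \<open>W\<close>. A functional dominated by it vanishes on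
  \<open>W\<close>, which is how Hahn--Banach separates a point from a subspace.\<close>

lemma quotient_seminorm:
  assumes "vector_space (s :: complex \<Rightarrow> 'v::ab_group_add \<Rightarrow> 'v)"
    and V: "module.subspace s V" and W: "module.subspace s W" and WV: "W \<subseteq> V"
    and p: "seminorm_on s V p" and pos: "\<And>x. x \<in> V \<Longrightarrow> 0 \<le> p x"
  shows "seminorm_on s V (\<lambda>x. INF w\<in>W. p (x - w))" (is "seminorm_on s V ?q")
    and "\<And>x w. x \<in> V \<Longrightarrow> w \<in> W \<Longrightarrow> (INF w\<in>W. p (x - w)) \<le> p (x - w)"
proof -
  interpret vector_space s by fact
  have padd: "p (x + y) \<le> p x + p y" if "x \<in> V" "y \<in> V" for x y
    using p that unfolding seminorm_on_def by blast
  have psc: "p (s c x) = cmod c * p x" if "x \<in> V" for c x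
    using p that unfolding seminorm_on_def by blast
  have diff: "x - w \<in> V" if "x \<in> V" "w \<in> W" for x w
    using V WV that subspace_diff by blast
  have W0: "0 \<in> W" and Wadd: "w \<in> W \<Longrightarrow> w' \<in> W \<Longrightarrow> w + w' \<in> W" and Wsc: "w \<in> W \<Longrightarrow> s c w \<in> W" for w w' c
    using W by (auto simp: subspace_def)
  show qle: "?q x \<le> p (x - w)" if "x \<in> V" "w \<in> W" for x w
    using that pos diff by (intro cINF_lower bdd_belowI2[where m = 0]) auto
  have qgr: "m \<le> ?q x" if "\<And>w. w \<in> W \<Longrightarrow> m \<le> p (x - w)" for x m
    using that W0 by (intro cINF_greatest) auto
  have add: "?q (x + y) \<le> ?q x + ?q y" if x: "x \<in> V" and y: "y \<in> V" for x y
  proof -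
    have xy: "x + y \<in> V" using V x y subspace_add by blast
    have "?q (x + y) - ?q y \<le> ?q x"
    proof (rule qgr)
      fix w assume w: "w \<in> W"
      have "?q (x + y) - p (x - w) \<le> ?q y"
      proof (rule qgr)
        fix w' assume w': "w' \<in> W"
        have "?q (x + y) \<le> p ((x + y) - (w + w'))"
          using qle[OF xy] Wadd w w' by blast
        also have "\<dots> = p ((x - w) + (y - w'))" by (simp add: algebra_simps)
        also have "\<dots> \<le> p (x - w) + p (y - w')" using padd diff x y w w' by blast
        finally show "?q (x + y) - p (x - w) \<le> p (y - w')" by simp
      qed
      then show "?q (x + y) - ?q y \<le> p (x - w)" by simp
    qed
    then show ?thesis by simp
  qed
  have le: "?q (s c x) \<le> cmod c * ?q x" if x: "x \<in> V" for c x
  proof (cases "c = 0")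
    case True
    have "?q (s c x) \<le> p 0" using qle[of 0 0] True W0 WV by auto
    also have "p 0 = 0" using psc[of 0 0] W0 WV by auto
    finally show ?thesis using True by simp
  next
    case False
    have "?q (s c x) / cmod c \<le> ?q x"
    proof (rule qgr)
      fix w assume w: "w \<in> W"
      have "?q (s c x) \<le> p (s c x - s c w)"
        using qle[of "s c x" "s c w"] Wsc[OF w] V x subspace_scale by blast
      also have "\<dots> = cmod c * p (x - w)"
        using psc[OF diff[OF x w], of c] by (simp add: scale_right_diff_distrib)
      finally show "?q (s c x) / cmod c \<le> p (x - w)"
        using False by (simp add: field_simps)
    qed
    then show ?thesis using False by (simp add: field_simps)
  qed
  have "?q (s c x) = cmod c * ?q x" if x: "x \<in> V" for c x
  proof (rule antisym[OF le[OF x]])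
    show "cmod c * ?q x \<le> ?q (s c x)"
    proof (cases "c = 0")
      case True
      have "0 \<le> ?q (s c x)"
        using V x subspace_scale by (intro qgr pos diff) auto
      with True show ?thesis by simp
    next
      case False
      \<comment> \<open>The reverse inequality is \<open>le\<close> applied to
        \<open>inverse c\<close>.\<close>
      have "?q (s (inverse c) (s c x)) \<le> cmod (inverse c) * ?q (s c x)"
        using le V x subspace_scale by blast
      then have "?q x \<le> inverse (cmod c) * ?q (s c x)"
        using False by (simp add: norm_inverse)
      moreover have "k * a \<le> b" if "a \<le> inverse k * b" "0 < k" for a b k :: real
        using that by (simp add: field_simps)
      ultimately show ?thesis using False by simp
    qed
  qed
  with add show "seminorm_on s V ?q" unfolding seminorm_on_def by blast
qed

section \<open>Bounded forms on a normed space\<close>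

text \<open>For a bounded form the least admissible \<open>K\<close> is the dual norm of
  \<open>\<Phi> x\<close>. Quantifying over all such \<open>K\<close> bounds it from below without a
  supremum, so that an empty unit sphere needs no special treatment.\<close>

definition bounded_below_form :: "'v set \<Rightarrow> ('v \<Rightarrow> real) \<Rightarrow> ('v \<Rightarrow> 'v \<Rightarrow> complex) \<Rightarrow> bool" where
  "bounded_below_form D N \<Phi> \<longleftrightarrow>
     (\<exists>c>0. \<forall>x\<in>D. \<forall>K\<ge>0. (\<forall>y\<in>D. cmod (\<Phi> x y) \<le> K * N y) \<longrightarrow> c * N x \<le> K)"

text \<open>Surjectivity of \<open>x \<mapsto> \<Phi> x\<close> onto the conjugate dual, as in the
  last condition of \<open>frakP\<close>.\<close>

definition represents_conj_dual ::
  "'v::complex_vector set \<Rightarrow> ('v \<Rightarrow> real) \<Rightarrow> ('v \<Rightarrow> 'v \<Rightarrow> complex) \<Rightarrow> bool" where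
  "represents_conj_dual D N \<Phi> \<longleftrightarrow>
     (\<forall>\<Lambda>\<in>conj_dual scaleC D N. \<exists>x\<in>D. \<forall>y\<in>D. \<Lambda> y = \<Phi> x y)"

definition adjoint_form :: "('v \<Rightarrow> 'v \<Rightarrow> complex) \<Rightarrow> 'v \<Rightarrow> 'v \<Rightarrow> complex" where
  "adjoint_form \<Phi> = (\<lambda>x y. cnj (\<Phi> y x))"

lemma adjoint_form_adjoint_form [simp]: "adjoint_form (adjoint_form \<Phi>) = \<Phi>"
  by (simp add: adjoint_form_def)

lemma vector_space_scale_fun: "vector_space (scale_fun :: complex \<Rightarrow> ('v \<Rightarrow> complex) \<Rightarrow> _)"
  by unfold_locales (auto simp: algebra_simps)

section \<open>Signs for the gliding hump\<close>

text \<open>Since \<open>z + b\<close> and \<open>z - b\<close> differ by \<open>2 * b\<close>, one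
  of them has modulus at least \<open>cmod b\<close>. Choosing each sign in this way prevents
  earlier terms from cancelling the diagonal entry.\<close>

lemma exists_signs_partial_sums:
  fixes a :: "nat \<Rightarrow> nat \<Rightarrow> complex"
  obtains \<sigma> :: "nat \<Rightarrow> complex"
  where "\<And>k. cmod (\<sigma> k) = 1" "\<And>n. cmod (a n n) \<le> cmod (\<Sum>k\<le>n. \<sigma> k * a k n)"
proof -
  have sign: "\<exists>e. cmod e = 1 \<and> cmod b \<le> cmod (z + e * b)" for z b :: complex
  proof (rule ccontr)
    assume "\<not> ?thesis"
    then have "cmod (z + 1 * b) < cmod b" "cmod (z + (- 1) * b) < cmod b"
      by (metis norm_one not_le norm_minus_cancel)+
    moreover have "cmod ((z + b) - (z - b)) \<le> cmod (z + b) + cmod (z - b)"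
      by (rule norm_triangle_ineq4)
    moreover have "cmod ((z + b) - (z - b)) = 2 * cmod b"
      by (simp flip: mult_2 add: norm_mult)
    ultimately show False by simp
  qed
  define e where "e z b = (SOME e. cmod e = 1 \<and> cmod b \<le> cmod (z + e * b))" for z b
  have e: "cmod (e z b) = 1" "cmod b \<le> cmod (z + e z b * b)" for z b
    using someI_ex[OF sign[of b z]] unfolding e_def by blast+
  \<comment> \<open>\<open>S n\<close> holds the partial sums of all columns at once: the sign
    chosen at stage \<open>n\<close> is read off column \<open>n\<close> but enters every
    column.\<close>
  define S where "S = rec_nat (\<lambda>_. 0) (\<lambda>n T m. T m + e (T n) (a n n) * a n m)"
  define \<sigma> where "\<sigma> n = e (S n n) (a n n)" for n
  have S: "S 0 = (\<lambda>_. 0)" "\<And>n. S (Suc n) = (\<lambda>m. S n m + \<sigma> n * a n m)"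
    by (simp_all add: S_def \<sigma>_def)
  have \<sigma>: "cmod (\<sigma> n) = 1" and le: "cmod (a n n) \<le> cmod (S (Suc n) n)" for n
    by (simp_all add: S \<sigma>_def e)
  have "S n m = (\<Sum>k<n. \<sigma> k * a k m)" for n m
    by (induction n) (simp_all add: S)
  then have "S (Suc n) n = (\<Sum>k\<le>n. \<sigma> k * a k n)" for n
    by (simp only: lessThan_Suc_atMost)
  with \<sigma> le show ?thesis by (intro that[of \<sigma>]) simp_all
qed

section \<open>Bounded forms, their adjoints, and the uniform boundedness argument\<close>

text \<open>These assumptions pass to the adjoint form, so that each result of the locale is
  available for \<open>\<Phi>\<close> and for its adjoint.\<close>

locale bounded_form =
  fixes D :: "'v::complex_vector set" and N :: "'v \<Rightarrow> real" and \<Phi> :: "'v \<Rightarrow> 'v \<Rightarrow> complex"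
  assumes subspace: "complex_vector.subspace D"
    and norm: "norm_on scaleC D N"
    and sesquilinear: "sesquilinear_on D \<Phi>"
    and bounded: "\<exists>\<beta>. \<forall>x\<in>D. \<forall>y\<in>D. cmod (\<Phi> x y) \<le> \<beta> * N x * N y"
begin

lemma zero_mem: "0 \<in> D"
  and add_mem: "x \<in> D \<Longrightarrow> y \<in> D \<Longrightarrow> x + y \<in> D"
  and diff_mem: "x \<in> D \<Longrightarrow> y \<in> D \<Longrightarrow> x - y \<in> D"
  and scale_mem: "x \<in> D \<Longrightarrow> c *\<^sub>C x \<in> D"
  using subspace
  by (auto intro: complex_vector.subspace_0 complex_vector.subspace_add
      complex_vector.subspace_diff complex_vector.subspace_scale)

lemma N_nonneg: "x \<in> D \<Longrightarrow> 0 \<le> N x"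
  and N_eq_0: "x \<in> D \<Longrightarrow> N x = 0 \<longleftrightarrow> x = 0"
  and N_scale: "x \<in> D \<Longrightarrow> N (c *\<^sub>C x) = cmod c * N x"
  and N_triangle: "x \<in> D \<Longrightarrow> y \<in> D \<Longrightarrow> N (x + y) \<le> N x + N y"
  using norm by (simp_all add: norm_on_def)

lemma form_add_left: "x \<in> D \<Longrightarrow> y \<in> D \<Longrightarrow> z \<in> D \<Longrightarrow> \<Phi> (x + y) z = \<Phi> x z + \<Phi> y z"
  and form_scale_left: "x \<in> D \<Longrightarrow> y \<in> D \<Longrightarrow> \<Phi> (c *\<^sub>C x) y = c * \<Phi> x y"
  and form_add_right: "x \<in> D \<Longrightarrow> y \<in> D \<Longrightarrow> z \<in> D \<Longrightarrow> \<Phi> x (y + z) = \<Phi> x y + \<Phi> x z"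
  and form_scale_right: "x \<in> D \<Longrightarrow> y \<in> D \<Longrightarrow> \<Phi> x (c *\<^sub>C y) = cnj c * \<Phi> x y"
  using sesquilinear by (simp_all add: sesquilinear_on_def)

lemma form_diff_left: "x \<in> D \<Longrightarrow> y \<in> D \<Longrightarrow> z \<in> D \<Longrightarrow> \<Phi> (x - y) z = \<Phi> x z - \<Phi> y z"
  using form_add_left[of "x - y" y z] by (simp add: diff_mem)

lemma bounded_form_adjoint: "bounded_form D N (adjoint_form \<Phi>)"
proof
  show "sesquilinear_on D (adjoint_form \<Phi>)"
    unfolding sesquilinear_on_def adjoint_form_def
    by (simp add: form_add_left form_add_right form_scale_left form_scale_right)
  show "\<exists>\<beta>. \<forall>x\<in>D. \<forall>y\<in>D. cmod (adjoint_form \<Phi> x y) \<le> \<beta> * N x * N y"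
    using bounded unfolding adjoint_form_def complex_mod_cnj by (metis mult.assoc mult.commute)
qed (fact subspace norm)+

text \<open>The conjugate of a norming linear functional, set to zero off \<open>D\<close> as
  \<open>conj_dual\<close> requires.\<close>

lemma norming_conj_functional:
  assumes v: "v \<in> D"
  obtains \<Lambda> where "\<Lambda> \<in> conj_dual scaleC D N" "\<And>x. x \<in> D \<Longrightarrow> cmod (\<Lambda> x) \<le> N x"
    "\<Lambda> v = complex_of_real (N v)"
proof -
  have "seminorm_on scaleC D N"
    unfolding seminorm_on_def by (simp add: N_triangle N_scale)
  then obtain f where f: "\<And>x y. f (x + y) = f x + f y" "\<And>c x. f (c *\<^sub>C x) = c * f x"
    "\<And>x. x \<in> D \<Longrightarrow> cmod (f x) \<le> N x" "f v = complex_of_real (N v)"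
    using norming_functional_on[OF complex_vector.vector_space_axioms subspace _ v] by blast
  define \<Lambda> where "\<Lambda> x = (if x \<in> D then cnj (f x) else 0)" for x
  have "\<exists>K. \<forall>x\<in>D. cmod (\<Lambda> x) \<le> K * N x"
    by (rule exI[of _ 1]) (simp add: \<Lambda>_def f)
  then have "\<Lambda> \<in> conj_dual scaleC D N"
    unfolding conj_dual_def by (simp add: \<Lambda>_def f add_mem scale_mem)
  then show ?thesis
    using that[of \<Lambda>] f v by (simp add: \<Lambda>_def)
qed

text \<open>Gliding hump: were the adjoint not bounded below, there would be \<open>y\<^sub>n\<close> with
  \<open>\<bar>\<Phi>(x, y\<^sub>n)\<bar> \<le> 4\<^sup>-\<^sup>n \<parallel>x\<parallel> \<parallel>y\<^sub>n\<parallel>\<close>, and \<open>\<Sum>\<^sub>k \<plusminus>3\<^sup>-\<^sup>k \<Lambda>\<^sub>k\<close> with \<open>\<Lambda>\<^sub>k\<close> norming for \<open>y\<^sub>k\<close> would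
  not be represented.\<close>

lemma represents_imp_adjoint_bounded_below:
  assumes rep: "represents_conj_dual D N \<Phi>"
  shows "bounded_below_form D N (adjoint_form \<Phi>)"
proof (rule ccontr)
  assume neg: "\<not> ?thesis"
  have "\<exists>y\<in>D. \<exists>K\<ge>0. (\<forall>x\<in>D. cmod (\<Phi> x y) \<le> K * N x) \<and> K < (1/4) ^ n * N y" for n :: nat
  proof -
    have "(1/4 :: real) ^ n > 0" by simp
    with neg show ?thesis
      unfolding bounded_below_form_def adjoint_form_def complex_mod_cnj by (metis not_le)
  qed
  then obtain y K where yD: "\<And>n. y n \<in> D" and K0: "\<And>n. (K :: nat \<Rightarrow> real) n \<ge> 0"
    and yK: "\<And>n x. x \<in> D \<Longrightarrow> cmod (\<Phi> x (y n)) \<le> K n * N x"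
    and K: "\<And>n. K n < (1/4) ^ n * N (y n)"
    by metis
  have Ny: "N (y n) > 0" for n
    using K0[of n] K[of n] by (metis le_less_trans zero_less_mult_pos zero_less_power
        zero_less_divide_1_iff zero_less_numeral)
  have "\<forall>n. \<exists>L. L \<in> conj_dual scaleC D N \<and> (\<forall>x\<in>D. cmod (L x) \<le> N x) \<and>
      L (y n) = complex_of_real (N (y n))"
  proof
    fix n
    obtain L where "L \<in> conj_dual scaleC D N" "\<And>x. x \<in> D \<Longrightarrow> cmod (L x) \<le> N x"
      "L (y n) = complex_of_real (N (y n))"
      using norming_conj_functional[OF yD[of n]] by blast
    then show "\<exists>L. L \<in> conj_dual scaleC D N \<and> (\<forall>x\<in>D. cmod (L x) \<le> N x) \<and>
      L (y n) = complex_of_real (N (y n))" by auto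
  qed
  from choice[OF this] obtain \<Lambda> where \<Lambda>: "\<And>n. \<Lambda> n \<in> conj_dual scaleC D N"
    and \<Lambda>_le: "\<And>n x. x \<in> D \<Longrightarrow> cmod (\<Lambda> n x) \<le> N x"
    and \<Lambda>y: "\<And>n. \<Lambda> n (y n) = complex_of_real (N (y n))"
    by blast
  obtain \<sigma> where \<sigma>: "\<And>k. cmod (\<sigma> k) = 1"
    and hump: "\<And>n. cmod ((1/3) ^ n * \<Lambda> n (y n)) \<le> cmod (\<Sum>k\<le>n. \<sigma> k * ((1/3) ^ k * \<Lambda> k (y n)))"
    using exists_signs_partial_sums[of "\<lambda>k n. (1/3) ^ k * \<Lambda> k (y n)"] by blast
  define t where "t x k = \<sigma> k * ((1/3) ^ k * \<Lambda> k x)" for x k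
  have t_le: "cmod (t x k) \<le> (1/3) ^ k * N x" if "x \<in> D" for x k
    using \<Lambda>_le[OF that, of k] by (simp add: t_def norm_mult \<sigma> norm_power norm_divide mult_left_mono)
  \<comment> \<open>The factor \<open>3/2\<close> is the sum of the geometric series with ratio
    \<open>1/3\<close>.\<close>
  have geo: "(\<lambda>k. (1/3 :: real) ^ (k + m) * r) sums ((1/3) ^ m * r * (3/2))" for m r
    using sums_mult[OF geometric_sums[of "1/3 :: real"], of "(1/3) ^ m * r"]
    by (simp add: power_add mult_ac)
  have summ: "summable (\<lambda>k. t x (k + m))" if "x \<in> D" for x m
    using t_le[OF that] by (intro summable_comparison_test'[OF sums_summable[OF geo[of m "N x"]]]) auto
  have suminf_le: "cmod (\<Sum>k. t x (k + m)) \<le> (1/3) ^ m * N x * (3/2)" if "x \<in> D" for x m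
    using norm_suminf_le[OF _ sums_summable[OF geo[of m "N x"]], of "\<lambda>k. t x (k + m)"]
      t_le[OF that] sums_unique[OF geo[of m "N x"]] by simp
  define L where "L x = (\<Sum>k. t x k)" for x
  have "L \<in> conj_dual scaleC D N"
  proof -
    have "L (u + v) = L u + L v" if "u \<in> D" "v \<in> D" for u v
    proof -
      have "t (u + v) = (\<lambda>k. t u k + t v k)"
      proof
        fix k
        show "t (u + v) k = t u k + t v k"
          using \<Lambda>[of k] that unfolding conj_dual_def t_def by (simp add: algebra_simps)
      qed
      then show ?thesis
        unfolding L_def using suminf_add[OF summ[OF that(1), of 0] summ[OF that(2), of 0]] by simp
    qed
    moreover have "L (c *\<^sub>C u) = cnj c * L u" if "u \<in> D" for c u
    proof -
      have "t (c *\<^sub>C u) = (\<lambda>k. cnj c * t u k)"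
      proof
        fix k
        show "t (c *\<^sub>C u) k = cnj c * t u k"
          using \<Lambda>[of k] that unfolding conj_dual_def t_def by (simp add: algebra_simps)
      qed
      then show ?thesis
        unfolding L_def using suminf_mult[OF summ[OF that, of 0], of "cnj c"] by simp
    qed
    moreover have "\<forall>u\<in>D. cmod (L u) \<le> 3/2 * N u"
      using suminf_le[of _ 0] by (simp add: L_def mult.commute)
    moreover have "L u = 0" if "u \<notin> D" for u
      using \<Lambda> that unfolding conj_dual_def L_def t_def by simp
    ultimately show ?thesis unfolding conj_dual_def by blast
  qed
  then obtain x where x: "x \<in> D" and Lx: "\<And>y. y \<in> D \<Longrightarrow> L y = \<Phi> x y"
    using rep unfolding represents_conj_dual_def by blast
  \<comment> \<open>The partial sum up to \<open>n\<close> at \<open>y n\<close> has modulus at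
    least \<open>(1/3) ^ n * N (y n)\<close>, and the tail from \<open>Suc n\<close> at most half of
    that. So \<open>cmod (L (y n))\<close> is at least the other half, while representation by
    \<open>x\<close> makes it at most \<open>(1/4) ^ n * N (y n) * N x\<close>.\<close>
  have "(4/3) ^ n \<le> 2 * N x" for n
  proof -
    have "L (y n) = (\<Sum>k. t (y n) (k + Suc n)) + (\<Sum>k\<le>n. t (y n) k)"
      unfolding L_def using suminf_split_initial_segment[OF summ[OF yD, of n 0, simplified], of "Suc n"]
      by (simp only: lessThan_Suc_atMost)
    then have "cmod (\<Sum>k\<le>n. t (y n) k) \<le> cmod (L (y n)) + cmod (\<Sum>k. t (y n) (k + Suc n))"
      by (metis add_diff_cancel_left' norm_triangle_ineq4)
    moreover have "(1/3) ^ n * N (y n) \<le> cmod (\<Sum>k\<le>n. t (y n) k)"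
      using hump[of n] Ny[of n] by (simp add: t_def \<Lambda>y norm_mult norm_power norm_divide)
    ultimately have "(1/3) ^ n * N (y n) \<le> 2 * cmod (L (y n))"
      using suminf_le[OF yD[of n], of "Suc n"] by simp
    also have "\<dots> \<le> 2 * (K n * N x)"
      using yK[OF x] Lx[OF yD] by simp
    also have "\<dots> \<le> 2 * ((1/4) ^ n * N (y n) * N x)"
      using mult_right_mono[OF less_imp_le[OF K[of n]] N_nonneg[OF x]] by simp
    finally have "(1/3) ^ n \<le> (1/4) ^ n * (2 * N x)"
      using Ny[of n] by (simp add: mult_ac)
    then show ?thesis by (simp add: power_divide field_simps)
  qed
  moreover obtain n where "2 * N x < (4/3) ^ n"
    using real_arch_pow[of "4/3" "2 * N x"] by auto
  ultimately show False by (metis not_le)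
qed

section \<open>The dual of \<open>D\<close> and its norm\<close>

lemma dual_norm_le:
  assumes "0 \<le> K" "\<And>x. x \<in> D \<Longrightarrow> cmod (f x) \<le> K * N x"
  shows "dual_norm D N f \<le> K"
  unfolding dual_norm_def
proof (rule cSUP_least)
  have "N 0 = 0" using N_eq_0 zero_mem by blast
  then show "{x \<in> D. N x \<le> 1} \<noteq> {}" using zero_mem by force
  fix x assume "x \<in> {x \<in> D. N x \<le> 1}"
  then show "cmod (f x) \<le> K"
    using assms mult_left_le[of "N x" K] by (auto intro: order_trans)
qed

lemma bdd_above_dual:
  assumes "f \<in> dual scaleC D N"
  shows "bdd_above ((\<lambda>x. cmod (f x)) ` {x \<in> D. N x \<le> 1})"
proof -
  obtain K where K: "\<And>x. x \<in> D \<Longrightarrow> cmod (f x) \<le> K * N x"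
    using assms unfolding dual_def by blast
  show ?thesis
  proof (rule bdd_aboveI2)
    fix z assume z: "z \<in> {x \<in> D. N x \<le> 1}"
    then have "cmod (f z) \<le> K * N z" using K by simp
    also have "\<dots> \<le> \<bar>K\<bar> * 1" using z N_nonneg by (intro mult_mono) auto
    finally show "cmod (f z) \<le> \<bar>K\<bar>" by simp
  qed
qed

text \<open>Normalising \<open>x\<close> brings it into the unit ball, where the supremum is finite
  by \<open>bdd_above_dual\<close>.\<close>

lemma dual_norm_bound:
  assumes f: "f \<in> dual scaleC D N" and x: "x \<in> D"
  shows "cmod (f x) \<le> dual_norm D N f * N x"
proof (cases "x = 0")
  case True
  have "f (0 *\<^sub>C x) = 0 * f x" using f x unfolding dual_def by blast
  with True have "f x = 0" by simp
  then show ?thesis using True N_eq_0[OF x] by simp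
next
  case False
  then have Nx: "N x > 0" using N_nonneg[OF x] N_eq_0[OF x] by simp
  define c where "c = complex_of_real (inverse (N x))"
  have "N (c *\<^sub>C x) = 1" using Nx N_scale[OF x] by (simp add: c_def norm_inverse)
  then have "cmod (f (c *\<^sub>C x)) \<le> dual_norm D N f"
    unfolding dual_norm_def using scale_mem[OF x] bdd_above_dual[OF f]
    by (intro cSUP_upper) auto
  moreover have "f (c *\<^sub>C x) = c * f x" using f x unfolding dual_def by blast
  ultimately have "inverse (N x) * cmod (f x) \<le> dual_norm D N f"
    using Nx by (simp add: c_def norm_mult norm_inverse)
  then show ?thesis
    using Nx by (simp add: field_simps)
qed

lemma dual_norm_nonneg:
  assumes "f \<in> dual scaleC D N"
  shows "0 \<le> dual_norm D N f"
proof -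
  have "N 0 = 0" using N_eq_0 zero_mem by blast
  then have "cmod (f 0) \<le> dual_norm D N f"
    unfolding dual_norm_def using zero_mem bdd_above_dual[OF assms]
    by (intro cSUP_upper) auto
  then show ?thesis using norm_ge_zero order_trans by blast
qed

lemma dual_add: "f \<in> dual scaleC D N \<Longrightarrow> g \<in> dual scaleC D N \<Longrightarrow> f + g \<in> dual scaleC D N"
proof -
  assume f: "f \<in> dual scaleC D N" and g: "g \<in> dual scaleC D N"
  have "cmod ((f + g) x) \<le> (dual_norm D N f + dual_norm D N g) * N x" if "x \<in> D" for x
    using dual_norm_bound[OF f that] dual_norm_bound[OF g that] norm_triangle_ineq[of "f x" "g x"]
    by (simp add: distrib_right)
  then have "\<exists>K. \<forall>x\<in>D. cmod ((f + g) x) \<le> K * N x" by blast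
  then show ?thesis
    using f g unfolding dual_def by (simp add: algebra_simps)
qed

lemma dual_scale: "f \<in> dual scaleC D N \<Longrightarrow> scale_fun c f \<in> dual scaleC D N"
proof -
  assume f: "f \<in> dual scaleC D N"
  have "cmod (c * f x) \<le> (cmod c * dual_norm D N f) * N x" if "x \<in> D" for x
    using mult_left_mono[OF dual_norm_bound[OF f that], of "cmod c"]
    by (simp add: norm_mult mult.assoc)
  then have "\<exists>K. \<forall>x\<in>D. cmod (c * f x) \<le> K * N x" by blast
  then show ?thesis
    using f unfolding dual_def by (simp add: algebra_simps)
qed

lemma dual_norm_add:
  assumes f: "f \<in> dual scaleC D N" and g: "g \<in> dual scaleC D N"
  shows "dual_norm D N (f + g) \<le> dual_norm D N f + dual_norm D N g"
proof (rule dual_norm_le)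
  fix x assume x: "x \<in> D"
  show "cmod ((f + g) x) \<le> (dual_norm D N f + dual_norm D N g) * N x"
    using dual_norm_bound[OF f x] dual_norm_bound[OF g x] norm_triangle_ineq[of "f x" "g x"]
    by (simp add: distrib_right)
qed (use dual_norm_nonneg[OF f] dual_norm_nonneg[OF g] in simp)

lemma dual_norm_scale:
  assumes f: "f \<in> dual scaleC D N"
  shows "dual_norm D N (scale_fun c f) = cmod c * dual_norm D N f"
proof (rule antisym)
  show "dual_norm D N (scale_fun c f) \<le> cmod c * dual_norm D N f"
    using dual_norm_nonneg[OF f] mult_left_mono[OF dual_norm_bound[OF f], of _ "cmod c"]
    by (intro dual_norm_le) (simp_all add: norm_mult mult.assoc)
  show "cmod c * dual_norm D N f \<le> dual_norm D N (scale_fun c f)"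
  proof (cases "c = 0")
    case True
    then show ?thesis using dual_norm_nonneg[OF dual_scale[OF f, of c]] by simp
  next
    case False
    \<comment> \<open>The reverse estimate bounds \<open>f\<close> through
      \<open>c * f\<close>.\<close>
    have "dual_norm D N f \<le> dual_norm D N (scale_fun c f) / cmod c"
    proof (rule dual_norm_le)
      show "0 \<le> dual_norm D N (scale_fun c f) / cmod c"
        using dual_norm_nonneg[OF dual_scale[OF f, of c]] by simp
      fix x assume "x \<in> D"
      then show "cmod (f x) \<le> dual_norm D N (scale_fun c f) / cmod c * N x"
        using dual_norm_bound[OF dual_scale[OF f, of c]] False
        by (simp add: norm_mult field_simps)
    qed
    then show ?thesis using False by (simp add: field_simps)
  qed
qed

lemma subspace_dual: "module.subspace scale_fun (dual scaleC D N)"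
proof -
  interpret vector_space scale_fun by (rule vector_space_scale_fun)
  have "0 \<in> dual scaleC D N"
    unfolding dual_def by (auto intro: exI[of _ 0])
  then show ?thesis
    unfolding subspace_def using dual_add dual_scale by blast
qed

lemma seminorm_on_dual: "seminorm_on scale_fun (dual scaleC D N) (dual_norm D N)"
  unfolding seminorm_on_def using dual_norm_add dual_norm_scale by blast

section \<open>Rows of the form and representation of functionals\<close>

text \<open>Conjugated because \<open>reflexive_on\<close> refers to the linear dual.\<close>

definition conj_row :: "'v \<Rightarrow> 'v \<Rightarrow> complex" where
  "conj_row x = (\<lambda>y. if y \<in> D then cnj (\<Phi> x y) else 0)"

lemma conj_row_dual: "x \<in> D \<Longrightarrow> conj_row x \<in> dual scaleC D N"
proof -
  assume x: "x \<in> D"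
  obtain \<beta> where "\<And>y. y \<in> D \<Longrightarrow> cmod (\<Phi> x y) \<le> (\<beta> * N x) * N y"
    using bounded x by blast
  then have "\<exists>K. \<forall>y\<in>D. cmod (conj_row x y) \<le> K * N y"
    unfolding conj_row_def by (intro exI[of _ "\<beta> * N x"]) simp
  then show ?thesis
    unfolding dual_def
    by (simp add: conj_row_def x add_mem scale_mem form_add_right form_scale_right)
qed

lemma subspace_conj_rows: "module.subspace scale_fun (conj_row ` D)"
proof -
  interpret vector_space scale_fun by (rule vector_space_scale_fun)
  have zero: "conj_row 0 = 0"
    using form_scale_left[OF zero_mem, of _ 0] by (auto simp: conj_row_def)
  have add: "conj_row x + conj_row y = conj_row (x + y)" if "x \<in> D" "y \<in> D" for x y
    using that by (auto simp: conj_row_def form_add_left)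
  \<comment> \<open>Conjugated rows depend conjugate linearly on \<open>x\<close>, whence
    \<open>cnj c\<close>.\<close>
  have sc: "scale_fun c (conj_row x) = conj_row (cnj c *\<^sub>C x)" if "x \<in> D" for x c
    using that by (auto simp: conj_row_def form_scale_left)
  show ?thesis
    unfolding subspace_def
    using zero_mem add_mem scale_mem by (auto simp: add sc zero[symmetric] simp del: zero)
qed

text \<open>A functional at distance zero from the rows of \<open>\<Phi>\<close> is a row by completeness. At positive
  distance, Hahn--Banach and reflexivity would give a nonzero \<open>x\<close> with \<open>\<Phi>(\<cdot>, x) = 0\<close>.\<close>

lemma bounded_below_imp_represents:
  assumes bb: "bounded_below_form D N \<Phi>"
    and complete: "complete_on D N" and reflexive: "reflexive_on scaleC D N"
    and nondeg: "\<And>y. y \<in> D \<Longrightarrow> (\<And>x. x \<in> D \<Longrightarrow> \<Phi> x y = 0) \<Longrightarrow> y = 0"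
  shows "represents_conj_dual D N \<Phi>"
  unfolding represents_conj_dual_def
proof
  fix \<Lambda> assume \<Lambda>: "\<Lambda> \<in> conj_dual scaleC D N"
  let ?V = "dual scaleC D N" and ?n = "dual_norm D N"
  interpret F: vector_space scale_fun by (rule vector_space_scale_fun)
  define f where "f x = cnj (\<Lambda> x)" for x
  have f: "f \<in> ?V"
    using \<Lambda> unfolding dual_def conj_dual_def f_def by auto
  \<comment> \<open>The distance to the rows in the dual norm; \<open>q f \<le> 0\<close> will say
    that \<open>f\<close> lies in the closure of the rows.\<close>
  define q where "q g = (INF w\<in>conj_row ` D. ?n (g - w))" for g
  have rows: "conj_row ` D \<subseteq> ?V" using conj_row_dual by blast
  have q: "seminorm_on scale_fun ?V q"
    and q_le_diff: "\<And>g w. g \<in> ?V \<Longrightarrow> w \<in> conj_row ` D \<Longrightarrow> q g \<le> ?n (g - w)"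
    unfolding q_def using quotient_seminorm[OF vector_space_scale_fun subspace_dual
        subspace_conj_rows rows seminorm_on_dual dual_norm_nonneg] by simp_all
  have n0: "?n 0 = 0"
    using dual_norm_scale[OF f, of 0] by (simp add: zero_fun_def)
  have q_row: "q (conj_row x) \<le> 0" if "x \<in> D" for x
    using q_le_diff[of "conj_row x" "conj_row x"] conj_row_dual[OF that] that n0 by simp
  have q_le: "q g \<le> ?n g" if "g \<in> ?V" for g
    using q_le_diff[OF that F.subspace_0[OF subspace_conj_rows]] by simp
  have "q f \<le> 0"
  proof (rule ccontr)
    assume pos: "\<not> q f \<le> 0"
    obtain \<phi> where \<phi>: "\<And>g h. \<phi> (g + h) = \<phi> g + \<phi> h" "\<And>c g. \<phi> (scale_fun c g) = c * \<phi> g"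
      "\<And>g. g \<in> ?V \<Longrightarrow> cmod (\<phi> g) \<le> q g" "\<phi> f = complex_of_real (q f)"
      using norming_functional_on[OF vector_space_scale_fun subspace_dual q f] by blast
    \<comment> \<open>Cutting off outside the dual turns \<open>\<phi>\<close> into an element of
      the bidual in the sense of \<open>dual\<close>, to which reflexivity applies.\<close>
    define \<psi> where "\<psi> g = (if g \<in> ?V then \<phi> g else 0)" for g
    have "\<exists>K. \<forall>g\<in>?V. cmod (\<psi> g) \<le> K * ?n g"
      using \<phi>(3) q_le unfolding \<psi>_def by (intro exI[of _ 1]) (auto intro: order_trans)
    then have "\<psi> \<in> dual scale_fun ?V ?n"
      unfolding dual_def[of scale_fun] using dual_add dual_scale
      by (simp add: \<psi>_def \<phi>)
    then obtain x where x: "x \<in> D" and eval: "\<And>g. g \<in> ?V \<Longrightarrow> \<psi> g = g x"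
      using reflexive unfolding reflexive_on_def by blast
    \<comment> \<open>As \<open>q\<close> is at most zero on rows, \<open>\<phi>\<close> vanishes
      there, and evaluation of a row at \<open>x\<close> is \<open>cnj (\<Phi> u x)\<close>.\<close>
    have "\<Phi> u x = 0" if u: "u \<in> D" for u
    proof -
      have "cmod (\<phi> (conj_row u)) \<le> 0"
        using \<phi>(3)[OF conj_row_dual[OF u]] q_row[OF u] by (rule order_trans)
      then show ?thesis
        using eval[OF conj_row_dual[OF u]] conj_row_dual[OF u] x
        by (simp add: \<psi>_def conj_row_def)
    qed
    then have "x = 0" using nondeg x by blast
    moreover have "f (0 *\<^sub>C x) = 0 * f x" using f x unfolding dual_def by blast
    ultimately have "f x = 0" by simp
    then have "\<phi> f = 0" using eval[OF f] f by (simp add: \<psi>_def)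
    then show False using \<phi>(4) pos by simp
  qed
  have "\<exists>x\<in>D. ?n (f - conj_row x) < inverse (real (Suc n))" for n
  proof (rule ccontr)
    assume "\<not> ?thesis"
    then have "inverse (real (Suc n)) \<le> q f"
      unfolding q_def using zero_mem by (intro cINF_greatest) (auto simp: not_less)
    then show False using \<open>q f \<le> 0\<close>
      by (metis inverse_positive_iff_positive not_le of_nat_0_less_iff order_trans zero_less_Suc)
  qed
  then obtain X where XD: "\<And>n. X n \<in> D" and "\<And>n. ?n (f - conj_row (X n)) < inverse (real (Suc n))"
    by metis
  then have Xf: "cmod (f y - cnj (\<Phi> (X n) y)) \<le> inverse (real (Suc n)) * N y" if "y \<in> D" for n y
  proof -
    have "f - conj_row (X n) \<in> ?V"
      using F.subspace_diff[OF subspace_dual f conj_row_dual[OF XD]] .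
    from dual_norm_bound[OF this that]
    have "cmod (f y - cnj (\<Phi> (X n) y)) \<le> ?n (f - conj_row (X n)) * N y"
      using that by (simp add: conj_row_def)
    also have "\<dots> \<le> inverse (real (Suc n)) * N y"
      using N_nonneg[OF that] \<open>?n (f - conj_row (X n)) < inverse (real (Suc n))\<close>
      by (intro mult_right_mono) auto
    finally show ?thesis .
  qed
  obtain c where c: "c > 0"
    and cN: "\<And>x K. x \<in> D \<Longrightarrow> 0 \<le> K \<Longrightarrow> (\<And>y. y \<in> D \<Longrightarrow> cmod (\<Phi> x y) \<le> K * N y) \<Longrightarrow> c * N x \<le> K"
    using bb unfolding bounded_below_form_def by blast
  \<comment> \<open>Two rows close to \<open>f\<close> are close to each other; the lower bound of
    the form transfers this from the rows to \<open>X m - X n\<close>.\<close>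
  have close: "c * N (X m - X n) \<le> inverse (real (Suc m)) + inverse (real (Suc n))" for m n
  proof (rule cN)
    fix y assume y: "y \<in> D"
    have "cmod (\<Phi> (X m - X n) y) = cmod ((f y - cnj (\<Phi> (X n) y)) - (f y - cnj (\<Phi> (X m) y)))"
      using form_diff_left[OF XD XD y] by (metis complex_cnj_diff complex_mod_cnj diff_diff_eq2
          add_diff_cancel_left' diff_add_cancel)
    also have "\<dots> \<le> cmod (f y - cnj (\<Phi> (X n) y)) + cmod (f y - cnj (\<Phi> (X m) y))"
      by (rule norm_triangle_ineq4)
    also have "\<dots> \<le> (inverse (real (Suc m)) + inverse (real (Suc n))) * N y"
      using Xf[OF y, of n] Xf[OF y, of m] by (simp add: distrib_right)
    finally show "cmod (\<Phi> (X m - X n) y) \<le> (inverse (real (Suc m)) + inverse (real (Suc n))) * N y" .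
  qed (use XD diff_mem in auto)
  have "\<exists>M. \<forall>m\<ge>M. \<forall>n\<ge>M. N (X n - X m) < e" if e: "e > 0" for e :: real
  proof -
    obtain M where M: "inverse (real (Suc M)) < c * e / 2"
      using c e reals_Archimedean[of "c * e / 2"] by auto
    have "N (X n - X m) < e" if "m \<ge> M" "n \<ge> M" for m n
    proof -
      have "inverse (real (Suc m)) \<le> inverse (real (Suc M))" "inverse (real (Suc n)) \<le> inverse (real (Suc M))"
        using that by (simp_all add: le_imp_inverse_le)
      then have "c * N (X n - X m) < c * e"
        using close[of n m] M by linarith
      then show ?thesis using c by simp
    qed
    then show ?thesis by blast
  qed
  then have "cauchy_on N X" by (simp add: cauchy_on_def)
  moreover have "range X \<subseteq> D" using XD by blast
  ultimately obtain x where x: "x \<in> D" and lim: "(\<lambda>n. N (X n - x)) \<longlonglongrightarrow> 0"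
    using complete unfolding complete_on_def by meson
  \<comment> \<open>The rows of \<open>X n\<close> converge at \<open>y\<close> to the row of
    \<open>x\<close> because the form is bounded, and to \<open>f\<close> by their choice.\<close>
  have "\<Lambda> y = \<Phi> x y" if y: "y \<in> D" for y
  proof -
    obtain \<beta> where \<beta>: "\<And>x y. x \<in> D \<Longrightarrow> y \<in> D \<Longrightarrow> cmod (\<Phi> x y) \<le> \<beta> * N x * N y"
      using bounded by blast
    have "(\<lambda>n. \<Phi> (X n) y - \<Phi> x y) \<longlonglongrightarrow> 0"
    proof (rule Lim_null_comparison)
      show "\<forall>\<^sub>F n in sequentially. cmod (\<Phi> (X n) y - \<Phi> x y) \<le> \<beta> * N (X n - x) * N y"
        using \<beta>[OF diff_mem[OF XD x] y] form_diff_left[OF XD x y] by simp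
      show "(\<lambda>n. \<beta> * N (X n - x) * N y) \<longlonglongrightarrow> 0"
        using lim by (auto intro!: tendsto_eq_intros)
    qed
    then have 1: "(\<lambda>n. \<Phi> (X n) y) \<longlonglongrightarrow> \<Phi> x y"
      by (simp add: LIM_zero_iff)
    have "(\<lambda>n. f y - cnj (\<Phi> (X n) y)) \<longlonglongrightarrow> 0"
    proof (rule Lim_null_comparison)
      show "\<forall>\<^sub>F n in sequentially. cmod (f y - cnj (\<Phi> (X n) y)) \<le> inverse (real (Suc n)) * N y"
        using Xf[OF y] by simp
      show "(\<lambda>n. inverse (real (Suc n)) * N y) \<longlonglongrightarrow> 0"
        by (rule tendsto_mult_left_zero[OF LIMSEQ_inverse_real_of_nat])
    qed
    moreover have "(\<lambda>n. f y - cnj (\<Phi> (X n) y)) \<longlonglongrightarrow> f y - cnj (\<Phi> x y)"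
      using 1 by (intro tendsto_intros)
    ultimately have "f y = cnj (\<Phi> x y)"
      using LIMSEQ_unique by fastforce
    then show ?thesis unfolding f_def by simp
  qed
  with x show "\<exists>x\<in>D. \<forall>y\<in>D. \<Lambda> y = \<Phi> x y" by blast
qed

section \<open>The supremum over the unit sphere, and statements 1 and 2\<close>

text \<open>Normalising \<open>y\<close> passes between the sphere and all of \<open>D\<close>. For
  \<open>D = {0}\<close> the sphere is empty and both sides hold.\<close>

lemma sup_sphere_le_iff:
  assumes x: "x \<in> D" and K: "0 \<le> K"
  shows "sup_sphere D N \<Phi> x \<le> ennreal K \<longleftrightarrow> (\<forall>y\<in>D. cmod (\<Phi> x y) \<le> K * N y)"
proof
  assume le: "sup_sphere D N \<Phi> x \<le> ennreal K"
  show "\<forall>y\<in>D. cmod (\<Phi> x y) \<le> K * N y"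
  proof
    fix y assume y: "y \<in> D"
    show "cmod (\<Phi> x y) \<le> K * N y"
    proof (cases "y = 0")
      case True
      then show ?thesis using form_scale_right[OF x y, of 0] N_eq_0[OF y] by simp
    next
      case False
      then have Ny: "N y > 0" using N_nonneg[OF y] N_eq_0[OF y] by simp
      define c where "c = complex_of_real (inverse (N y))"
      have "N (c *\<^sub>C y) = 1" using Ny N_scale[OF y] by (simp add: c_def norm_inverse)
      then have "ennreal (cmod (\<Phi> x (c *\<^sub>C y))) \<le> sup_sphere D N \<Phi> x"
        unfolding sup_sphere_def using scale_mem[OF y] by (intro SUP_upper) auto
      with le have "cmod (\<Phi> x (c *\<^sub>C y)) \<le> K"
        using K by (metis ennreal_le_iff order_trans)
      then have "inverse (N y) * cmod (\<Phi> x y) \<le> K"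
        using Ny form_scale_right[OF x y, of c] by (simp add: c_def norm_mult norm_inverse)
      then show ?thesis
        using Ny by (simp add: field_simps)
    qed
  qed
next
  assume "\<forall>y\<in>D. cmod (\<Phi> x y) \<le> K * N y"
  then show "sup_sphere D N \<Phi> x \<le> ennreal K"
    unfolding sup_sphere_def by (intro SUP_least ennreal_leI) fastforce
qed

text \<open>Boundedness of the form keeps the supremum below \<open>top\<close>, so that it can be
  compared as a real number.\<close>

lemma sup_sphere_eq_ennreal:
  assumes x: "x \<in> D"
  obtains K where "0 \<le> K" "sup_sphere D N \<Phi> x = ennreal K"
proof -
  obtain \<beta> where \<beta>: "\<And>y. y \<in> D \<Longrightarrow> cmod (\<Phi> x y) \<le> \<beta> * N x * N y"
    using bounded x by blast
  have "\<forall>y\<in>D. cmod (\<Phi> x y) \<le> \<bar>\<beta> * N x\<bar> * N y"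
    using \<beta> by (meson N_nonneg abs_ge_self mult_right_mono order_trans)
  then have "sup_sphere D N \<Phi> x \<le> ennreal \<bar>\<beta> * N x\<bar>"
    using sup_sphere_le_iff[OF x] by simp
  then have "sup_sphere D N \<Phi> x < top"
    using ennreal_less_top le_less_trans by blast
  then show ?thesis
    by (metis that ennreal_cases less_irrefl infinity_ennreal_def)
qed

text \<open>By \<open>sup_sphere_le_iff\<close> the admissible bounds are the nonnegative reals
  above the supremum, and the supremum is the least of them.\<close>

lemma bounded_below_form_iff_sup_sphere:
  "bounded_below_form D N \<Phi> \<longleftrightarrow> (\<exists>c>0. \<forall>x\<in>D. ennreal (c * N x) \<le> sup_sphere D N \<Phi> x)"
proof -
  have "(\<forall>K\<ge>0. (\<forall>y\<in>D. cmod (\<Phi> x y) \<le> K * N y) \<longrightarrow> c * N x \<le> K) \<longleftrightarrow>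
      ennreal (c * N x) \<le> sup_sphere D N \<Phi> x" if x: "x \<in> D" for c x
  proof -
    obtain K where K: "0 \<le> K" "sup_sphere D N \<Phi> x = ennreal K"
      using sup_sphere_eq_ennreal[OF x] by blast
    have "(\<forall>L\<ge>0. (\<forall>y\<in>D. cmod (\<Phi> x y) \<le> L * N y) \<longrightarrow> c * N x \<le> L) \<longleftrightarrow>
        (\<forall>L\<ge>0. K \<le> L \<longrightarrow> c * N x \<le> L)"
      using sup_sphere_le_iff[OF x] K by (simp add: ennreal_le_iff)
    also have "\<dots> \<longleftrightarrow> c * N x \<le> K"
      using K(1) by (auto intro: order_trans)
    also have "\<dots> \<longleftrightarrow> ennreal (c * N x) \<le> sup_sphere D N \<Phi> x"
      using K by (simp add: ennreal_le_iff)
    finally show ?thesis .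
  qed
  then show ?thesis unfolding bounded_below_form_def by simp
qed

text \<open>If no constant works, normalised witnesses against the constants \<open>1/(n+1)\<close>
  form a sequence of norm one whose suprema tend to zero.\<close>

lemma bounded_below_form_iff_sequential:
  "bounded_below_form D N \<Phi> \<longleftrightarrow>
     (\<forall>X. range X \<subseteq> D \<and> (\<lambda>n. sup_sphere D N \<Phi> (X n)) \<longlonglongrightarrow> 0 \<longrightarrow> (\<lambda>n. N (X n)) \<longlonglongrightarrow> 0)"
    (is "_ \<longleftrightarrow> ?seq")
proof
  assume "bounded_below_form D N \<Phi>"
  then obtain c where c: "c > 0" and cN: "\<And>x. x \<in> D \<Longrightarrow> ennreal (c * N x) \<le> sup_sphere D N \<Phi> x"
    unfolding bounded_below_form_iff_sup_sphere by blast
  show ?seq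
  proof (intro allI impI, elim conjE)
    fix X assume X: "range X \<subseteq> D" and lim: "(\<lambda>n. sup_sphere D N \<Phi> (X n)) \<longlonglongrightarrow> 0"
    have XD: "X n \<in> D" for n using X by blast
    have "(\<lambda>n. ennreal (c * N (X n))) \<longlonglongrightarrow> ennreal 0"
      by (rule tendsto_sandwich[OF _ _ tendsto_const]) (use cN[OF XD] lim in auto)
    \<comment> \<open>\<open>ennreal\<close> truncates negative numbers, so nonnegativity of
      \<open>N\<close> is what brings the limit back to the reals.\<close>
    then have "(\<lambda>n. c * N (X n)) \<longlonglongrightarrow> 0"
      using c N_nonneg[OF XD] by (subst (asm) tendsto_ennreal_iff) auto
    then have "(\<lambda>n. inverse c * (c * N (X n))) \<longlonglongrightarrow> inverse c * 0"
      by (intro tendsto_mult tendsto_const)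
    then show "(\<lambda>n. N (X n)) \<longlonglongrightarrow> 0"
      using c by simp
  qed
next
  assume seq: ?seq
  show "bounded_below_form D N \<Phi>"
  proof (rule ccontr)
    assume neg: "\<not> bounded_below_form D N \<Phi>"
    have "\<exists>x\<in>D. N x = 1 \<and> sup_sphere D N \<Phi> x \<le> ennreal (inverse (real (Suc n)))" for n
    proof -
      have "inverse (real (Suc n)) > 0" by simp
      with neg obtain x K where x: "x \<in> D" and K: "0 \<le> K" "\<And>y. y \<in> D \<Longrightarrow> cmod (\<Phi> x y) \<le> K * N y"
        and less: "K < inverse (real (Suc n)) * N x"
        unfolding bounded_below_form_def by (metis not_le)
      have Nx: "N x > 0"
        using N_nonneg[OF x] K(1) less by (cases "N x = 0") auto
      define c where "c = complex_of_real (inverse (N x))"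
      have cx: "c *\<^sub>C x \<in> D" using scale_mem[OF x] .
      have "cmod (\<Phi> (c *\<^sub>C x) y) \<le> inverse (real (Suc n)) * N y" if y: "y \<in> D" for y
      proof -
        have "cmod (\<Phi> (c *\<^sub>C x) y) = inverse (N x) * cmod (\<Phi> x y)"
          using Nx form_scale_left[OF x y] by (simp add: c_def norm_mult norm_inverse)
        also have "\<dots> \<le> inverse (N x) * (inverse (real (Suc n)) * N x * N y)"
          using Nx K(2)[OF y] mult_right_mono[OF less_imp_le[OF less] N_nonneg[OF y]]
          by (intro mult_left_mono) auto
        also have "\<dots> = inverse (real (Suc n)) * N y"
          using Nx by simp
        finally show ?thesis .
      qed
      then have "sup_sphere D N \<Phi> (c *\<^sub>C x) \<le> ennreal (inverse (real (Suc n)))"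
        using sup_sphere_le_iff[OF cx] by simp
      moreover have "N (c *\<^sub>C x) = 1" using Nx N_scale[OF x] by (simp add: c_def norm_inverse)
      ultimately show ?thesis using cx by blast
    qed
    then obtain X where X: "\<And>n. X n \<in> D" "\<And>n. N (X n) = 1"
      and le: "\<And>n. sup_sphere D N \<Phi> (X n) \<le> ennreal (inverse (real (Suc n)))"
      by metis
    have "(\<lambda>n. ennreal (inverse (real (Suc n)))) \<longlonglongrightarrow> ennreal 0"
      by (intro tendsto_ennrealI LIMSEQ_inverse_real_of_nat)
    then have lim: "(\<lambda>n. ennreal (inverse (real (Suc n)))) \<longlonglongrightarrow> 0" by simp
    have "(\<lambda>n. sup_sphere D N \<Phi> (X n)) \<longlonglongrightarrow> 0"
      by (rule tendsto_sandwich[OF always_eventually always_eventually tendsto_const lim])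
        (simp_all only: le zero_le simp_thms)
    moreover have "range X \<subseteq> D" using X(1) by blast
    ultimately have "(\<lambda>n. N (X n)) \<longlonglongrightarrow> 0" using seq by simp
    then show False using X(2) by (simp add: LIMSEQ_const_iff)
  qed
qed

text \<open>The diagonal condition is the same for \<open>\<Phi>\<close> and its adjoint, and gives
  the nondegeneracy that \<open>bounded_below_imp_represents\<close> asks of either. The forward
  direction passes to the adjoint and back.\<close>

lemma represents_iff_bounded_below:
  assumes "complete_on D N" "reflexive_on scaleC D N"
    and diag: "\<And>x. x \<in> D \<Longrightarrow> \<Phi> x x = 0 \<Longrightarrow> x = 0"
  shows "represents_conj_dual D N \<Phi> \<longleftrightarrow> bounded_below_form D N \<Phi>"
proof
  interpret adj: bounded_form D N "adjoint_form \<Phi>" by (rule bounded_form_adjoint)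
  assume "represents_conj_dual D N \<Phi>"
  then have "bounded_below_form D N (adjoint_form \<Phi>)"
    by (rule represents_imp_adjoint_bounded_below)
  then have "represents_conj_dual D N (adjoint_form \<Phi>)"
    using assms(1,2) by (rule adj.bounded_below_imp_represents)
      (use diag in \<open>auto simp: adjoint_form_def\<close>)
  from adj.represents_imp_adjoint_bounded_below[OF this]
  show "bounded_below_form D N \<Phi>" by simp
next
  assume "bounded_below_form D N \<Phi>"
  then show "represents_conj_dual D N \<Phi>"
    using assms(1,2) by (rule bounded_below_imp_represents) (use diag in blast)
qed

end

section \<open>Disjoint numerical ranges and membership in \<open>frakP\<close>\<close>

theorem theorem5p2:
  fixes D :: "'h::complex_hilbert_space set"
    and N :: "'h \<Rightarrow> real"
    and \<Omega> \<Upsilon> :: "'h \<Rightarrow> 'h \<Rightarrow> complex"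
  assumes "complex_vector.subspace D" and "closure D = UNIV"
    and "sesquilinear_on D \<Omega>"
    and "norm_on scaleC D N"
    and "q_closed D N \<Omega>"
    and "bounded_sesquilinear \<Upsilon>"
    and "numerical_range D \<Omega> \<inter> numerical_range UNIV (- \<Upsilon>) = {}"
  shows "(\<Upsilon> \<in> frakP D N \<Omega> \<longleftrightarrow>
           (\<forall>X. range X \<subseteq> D \<and> (\<lambda>n. sup_sphere D N (\<Omega> + \<Upsilon>) (X n)) \<longlonglongrightarrow> 0
              \<longrightarrow> (\<lambda>n. N (X n)) \<longlonglongrightarrow> 0)) \<and>
         (\<Upsilon> \<in> frakP D N \<Omega> \<longleftrightarrow>
           (\<exists>c>0. \<forall>\<xi>\<in>D. ennreal (c * N \<xi>) \<le> sup_sphere D N (\<Omega> + \<Upsilon>) \<xi>))"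
proof -
  obtain \<alpha> \<beta> K where \<alpha>: "\<alpha> > 0" "\<And>x. x \<in> D \<Longrightarrow> norm x \<le> \<alpha> * N x"
    and \<beta>: "\<And>x y. x \<in> D \<Longrightarrow> y \<in> D \<Longrightarrow> cmod (\<Omega> x y) \<le> \<beta> * N x * N y"
    and K: "\<And>x y. cmod (\<Upsilon> x y) \<le> K * norm x * norm y"
  proof -
    obtain \<alpha> where "\<alpha> > 0" "\<forall>x\<in>D. norm x \<le> \<alpha> * N x"
      using assms(5) unfolding q_closed_def by blast
    moreover obtain \<beta> where "\<forall>x\<in>D. \<forall>y\<in>D. cmod (\<Omega> x y) \<le> \<beta> * N x * N y"
      using assms(5) unfolding q_closed_def by blast
    moreover obtain K where "\<forall>x y. cmod (\<Upsilon> x y) \<le> K * norm x * norm y"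
      using assms(6) unfolding bounded_sesquilinear_def by blast
    ultimately show ?thesis by (intro that) auto
  qed
  have \<Upsilon>: "sesquilinear_on UNIV \<Upsilon>"
    using assms(6) unfolding bounded_sesquilinear_def by blast
  interpret bounded_form D N "\<Omega> + \<Upsilon>"
  proof
    show "sesquilinear_on D (\<Omega> + \<Upsilon>)"
      using assms(3) \<Upsilon> unfolding sesquilinear_on_def by (simp add: distrib_left)
    \<comment> \<open>Each of the two comparisons of \<open>norm\<close> with \<open>N\<close> costs
      a factor \<open>\<alpha>\<close>; the absolute value is there because \<open>K\<close> is not
      known to be nonnegative.\<close>
    have "cmod ((\<Omega> + \<Upsilon>) x y) \<le> (\<beta> + \<bar>K\<bar> * \<alpha> * \<alpha>) * N x * N y" if x: "x \<in> D" and y: "y \<in> D" for x y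
    proof -
      have "cmod (\<Upsilon> x y) \<le> \<bar>K\<bar> * (norm x * norm y)"
        using K[of x y] by (metis abs_ge_self mult.assoc mult_right_mono norm_ge_zero
            order_trans zero_le_mult_iff)
      also have "\<dots> \<le> \<bar>K\<bar> * ((\<alpha> * N x) * (\<alpha> * N y))"
        using \<alpha>(2)[OF x] \<alpha>(2)[OF y]
        by (intro mult_left_mono mult_mono) (auto intro: order_trans[OF norm_ge_zero])
      finally show ?thesis
        using \<beta>[OF x y] norm_triangle_ineq[of "\<Omega> x y" "\<Upsilon> x y"] by (simp add: algebra_simps)
    qed
    then show "\<exists>\<beta>. \<forall>x\<in>D. \<forall>y\<in>D. cmod ((\<Omega> + \<Upsilon>) x y) \<le> \<beta> * N x * N y" by blast
  qed (fact assms)+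
  have diag: "x = 0" if x: "x \<in> D" and zero: "(\<Omega> + \<Upsilon>) x x = 0" for x
  proof (rule ccontr)
    assume "x \<noteq> 0"
    \<comment> \<open>On the normalised vector, \<open>\<Omega> u u = - \<Upsilon> u u\<close> would
      be a common point of the two numerical ranges.\<close>
    define u where "u = complex_of_real (inverse (norm x)) *\<^sub>C x"
    have u: "u \<in> D" unfolding u_def by (rule scale_mem[OF x])
    have nu: "norm u = 1"
      using \<open>x \<noteq> 0\<close> unfolding u_def scaleC_of_real by simp
    have "(\<Omega> + \<Upsilon>) u u = 0"
      using form_scale_left[OF x u] form_scale_right[OF x x] zero unfolding u_def by simp
    then have "\<Omega> u u = (- \<Upsilon>) u u" by (simp add: eq_neg_iff_add_eq_0)
    then have "\<Omega> u u \<in> numerical_range D \<Omega> \<inter> numerical_range UNIV (- \<Upsilon>)"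
      using u nu unfolding numerical_range_def by blast
    with assms(7) show False by simp
  qed
  have "complete_on D N" "reflexive_on scaleC D N"
    using assms(5) unfolding q_closed_def by blast+
  then have "represents_conj_dual D N (\<Omega> + \<Upsilon>) \<longleftrightarrow> bounded_below_form D N (\<Omega> + \<Upsilon>)"
    using diag by (rule represents_iff_bounded_below)
  moreover have "\<Upsilon> \<in> frakP D N \<Omega> \<longleftrightarrow> represents_conj_dual D N (\<Omega> + \<Upsilon>)"
  proof -
    \<comment> \<open>The injectivity condition of \<open>frakP\<close> follows by testing with
      \<open>\<eta> = \<xi>\<close>.\<close>
    have "\<xi> = 0" if "\<xi> \<in> D" "\<forall>\<eta>\<in>D. (\<Omega> + \<Upsilon>) \<xi> \<eta> = 0" for \<xi>
      using diag that by simp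
    then show ?thesis
      using assms(6) by (simp add: frakP_def represents_conj_dual_def)
  qed
  ultimately show ?thesis
    using bounded_below_form_iff_sequential bounded_below_form_iff_sup_sphere by simp
qed

end
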